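(* Let $p$ be an odd prime, let $\alpha$ be a primitive element of $\mathbb{F}_p$, let $\mathbf{s}$ be the SLCE sequence over $\mathbb{F}_p^*$ defined using $\alpha$, and let $S\subset \mathbb{Z}/(p-1)\mathbb{Z}$ be the corresponding SLCE almost difference set. Then the multiplier group of $S$ is trivial (i.e. equal to $\{1\}$), and $\mathcal{F}_1 = \{ \mathbf{s}[t'] : t \in (\mathbb{Z}/(p-1)\mathbb{Z})^* \}$ is a family of $\phi(p-1)$ pairwise shift-inequivalent decimations of $\mathbf{s}$.
   Context: SLCE sequence: let $q$ be a power of an odd prime and $\alpha$ a primitive element of $\mathbb{F}_q$. The Sidelnikov-Lempel-Cohn-Eastman (SLCE) sequence $\mathbf{s}=s_0s_1s_2\ldots$ over $\mathbb{F}_q^*$ defined using $\alpha$ is the binary sequence, periodic with $s_{j+q-1}=s_j$, given for $0\le j<q-1$ by $s_j=0$ if $\alpha^j+1$ is $0$ or a nonzero square in $\mathbb{F}_q$, and $s_j=1$ if $\alpha^j+1$ is a nonsquare in $\mathbb{F}_q$. The corresponding SLCE almost difference set is $S=\{j\in\mathbb{Z}/(q-1)\mathbb{Z} : s_j=1\}$ (equivalently, via $j\mapsto\alpha^j$, a subset of the cyclic group $\mathbb{F}_q^*$). Here $q=p$. Multipliers: a residue $t\in(\mathbb{Z}/(q-1)\mathbb{Z})^*$ is a multiplier of $S$ if there is $c\in\mathbb{Z}/(q-1)\mathbb{Z}$ with $\{tj : j\in S\}=\{j+c : j\in S\}$. The multipliers of $S$ form a subgroup of $(\mathbb{Z}/(q-1)\mathbb{Z})^*$,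 the multiplier group. For a residue class $r\in\mathbb{Z}/n\mathbb{Z}$, $r'$ denotes the least positive integer in the class $r$. For an integer $t\ge1$, the decimation $\mathbf{a}[t]$ of a sequence $\mathbf{a}$ is the sequence whose $i$th entry is $a_{ti}$. Two periodic sequences $\mathbf{a},\mathbf{b}$ of the same period are shift-equivalent if there is an integer $\ell$ such that $a_i=b_{i+\ell}$ for all $i$ (indices read modulo the period), and shift-inequivalent otherwise. $\phi$ is the Euler totient function.
   Formalization: The prime p = 5 is excluded, since there the claim fails for both primitive elements: for α = 2, S = {0,1} and 3S = {0,3} = S + 3 in Z/4Z, so 3 is a nontrivial multiplier and s[3] is a shift of s. *)

theory Defs
  imports "HOL-Number_Theory.Number_Theory" "HOL-Library.Cardinality"
    "HOL-Computational_Algebra.Nth_Powers"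
begin

text \<open>A finite field is a type of sort \<open>{field, finite}\<close>, so that \<open>q = CARD('a)\<close>. The ring of integers
  modulo \<open>n\<close> is the library's \<open>residue_ring (int n)\<close>, with carrier \<open>{0..int n - 1}\<close>.\<close>

definition primitive_element :: "'a::{field, finite} \<Rightarrow> bool"
  where "primitive_element \<alpha> \<longleftrightarrow> range (\<lambda>i::nat. \<alpha> ^ i) = UNIV - {0}"

definition slce_seq :: "'a::{field, finite} \<Rightarrow> nat \<Rightarrow> nat"
  where "slce_seq \<alpha> j =
    (let z = \<alpha> ^ (j mod (CARD('a) - 1)) + 1
     in if z = 0 \<or> (z \<noteq> 0 \<and> is_square z) then 0 else 1)"

definition slce_ads :: "'a::{field, finite} \<Rightarrow> int set"
  where "slce_ads \<alpha> =
    {j \<in> carrier (residue_ring (int (CARD('a) - 1))). slce_seq \<alpha> (nat j) = 1}"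

text \<open>The underlying set of the multiplier group. For the set \<open>S = slce_ads \<alpha>\<close> over the field with
  5 elements it is not trivial: \<open>S = {0, 1}\<close> and \<open>3 * S = {0, 3} = S + 3\<close> if \<open>\<alpha> = 2\<close>, and
  \<open>S = {0, 3}\<close> and \<open>3 * S = {0, 1} = S + 1\<close> if \<open>\<alpha> = 3\<close>.\<close>

definition multipliers :: "nat \<Rightarrow> int set \<Rightarrow> int set"
  where "multipliers n S =
    (let R = residue_ring (int n)
     in {t \<in> Units R. \<exists>c \<in> carrier R. (\<lambda>j. t \<otimes>\<^bsub>R\<^esub> j) ` S = (\<lambda>j. j \<oplus>\<^bsub>R\<^esub> c) ` S})"

definition least_pos_rep :: "nat \<Rightarrow> int \<Rightarrow> nat"
  where "least_pos_rep n r = (LEAST k. k > 0 \<and> [int k = r] (mod int n))"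

definition decimation :: "(nat \<Rightarrow> 'b) \<Rightarrow> nat \<Rightarrow> nat \<Rightarrow> 'b"
  where "decimation a t = (\<lambda>i. a (t * i))"

text \<open>Shift-equivalence of two sequences of period \<open>n\<close>; the shift \<open>l\<close> may be negative, hence the
  reduction of the index modulo the period.\<close>

definition shift_equivalent :: "nat \<Rightarrow> (nat \<Rightarrow> 'b) \<Rightarrow> (nat \<Rightarrow> 'b) \<Rightarrow> bool"
  where "shift_equivalent n a b \<longleftrightarrow>
    (\<exists>l::int. \<forall>i. a i = b (nat ((int i + l) mod int n)))"

definition slce_family :: "'a::{field, finite} \<Rightarrow> (nat \<Rightarrow> nat) set"
  where "slce_family \<alpha> =
    (\<lambda>t. decimation (slce_seq \<alpha>) (least_pos_rep (CARD('a) - 1) t)) `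
      Units (residue_ring (int (CARD('a) - 1)))"

end

theory Submission
  imports Defs
begin

text \<open>Write \<open>p = 2m + 1\<close>. On the nonzero elements of the field, the sign version of the sequence is the
  function \<open>(x + 1)^m + [x = -1]\<close>. Its Fourier coefficients over the field itself are, up to sign,
  \<open>d(l) = 1 - (-1)^l (m choose l)\<close> for \<open>0 \<le> l < 2m\<close>, so that \<open>d(1) = 1/2\<close>, \<open>d(2) = 5/8\<close>, and \<open>d(l) = 1\<close>
  exactly when \<open>l > m\<close>. If the sign function is invariant under \<open>x \<mapsto> b x^t\<close>, then
  \<open>d(t l) = b^l d(l)\<close> for all \<open>l\<close> modulo \<open>2m\<close>. Let \<open>1 < t < 2m\<close> and \<open>m \<ge> 3\<close>. If \<open>t < m\<close>, then \<open>l = -1\<close>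
  gives \<open>b = 1\<close>, but some \<open>k \<le> m\<close> has \<open>m < t k < 2m\<close>, whence \<open>1 = d(t k) = d(k) \<noteq> 1\<close>. If \<open>t > m\<close>, then
  \<open>l = 1\<close> gives \<open>b = 2\<close>, hence \<open>d(2t) = 5/2\<close> and \<open>d(-2t) = 1/4\<close>, although one of these two values is
  \<open>1\<close> or they coincide.\<close>

section \<open>Primitive elements of finite fields\<close>

text \<open>Multiplication by \<open>x\<close> permutes the nonzero elements, so it preserves their
  nonzero product.\<close>

lemma power_card_minus_1_eq_1:
  fixes x :: "'a::{field, finite}"
  assumes "x \<noteq> 0"
  shows "x ^ (CARD('a) - 1) = 1"
proof -
  have "x ^ (CARD('a) - 1) * \<Prod>(UNIV - {0}) = (\<Prod>y\<in>UNIV - {0}. x * y)"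
    by (simp add: prod.distrib)
  also have "\<dots> = \<Prod>(UNIV - {0})"
    by (rule prod.reindex_bij_witness[of _ "\<lambda>y. y / x" "\<lambda>y. x * y"]) (use assms in auto)
  finally show ?thesis
    by simp
qed

lemma card_field_ge_2: "CARD('a::{field, finite}) \<ge> 2"
proof -
  have "card {0, 1 :: 'a} \<le> CARD('a)"
    by (rule card_mono) auto
  then show ?thesis
    by simp
qed

lemma primitive_element_nonzero:
  fixes \<alpha> :: "'a::{field, finite}"
  assumes "primitive_element \<alpha>"
  shows "\<alpha> \<noteq> 0"
proof -
  have "\<alpha> ^ 1 \<in> UNIV - {0}"
    using assms unfolding primitive_element_def by blast
  then show ?thesis
    by simp
qed

lemma power_mod_card_minus_1:
  fixes x :: "'a::{field, finite}"
  assumes "x \<noteq> 0"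
  shows "x ^ (i mod (CARD('a) - 1)) = x ^ i"
proof -
  have "x ^ i = x ^ ((CARD('a) - 1) * (i div (CARD('a) - 1)) + i mod (CARD('a) - 1))"
    by (simp only: mult_div_mod_eq)
  also have "\<dots> = x ^ (i mod (CARD('a) - 1))"
    unfolding power_add power_mult power_card_minus_1_eq_1[OF assms] by simp
  finally show ?thesis by simp
qed

text \<open>If a positive \<open>r\<close> below q - 1 had \<open>\<alpha> ^ r = 1\<close>, the
  powers of \<open>\<alpha>\<close> would take at most \<open>r\<close> values, too few to cover the
  nonzero elements.\<close>

lemma primitive_element_power_eq_1_iff:
  fixes \<alpha> :: "'a::{field, finite}"
  assumes "primitive_element \<alpha>"
  shows "\<alpha> ^ i = 1 \<longleftrightarrow> CARD('a) - 1 dvd i"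
proof
  note [simp] = primitive_element_nonzero[OF assms]
  show "\<alpha> ^ i = 1" if "CARD('a) - 1 dvd i"
    using that power_card_minus_1_eq_1[of \<alpha>] by (auto simp: power_mult)
  assume "\<alpha> ^ i = 1"
  define r where "r = i mod (CARD('a) - 1)"
  have r: "\<alpha> ^ r = 1" "r < CARD('a) - 1"
    using \<open>\<alpha> ^ i = 1\<close> card_field_ge_2[where 'a = 'a]
    by (auto simp: r_def power_mod_card_minus_1 simp del: One_nat_def)
  have "r = 0"
  proof (rule ccontr)
    assume "r \<noteq> 0"
    have "\<alpha> ^ k \<in> (\<lambda>i. \<alpha> ^ i) ` {..<r}" for k
    proof -
      have "\<alpha> ^ k = \<alpha> ^ (r * (k div r) + k mod r)"
        by (simp only: mult_div_mod_eq)
      also have "\<dots> = \<alpha> ^ (k mod r)"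
        unfolding power_add power_mult r(1) by simp
      finally show ?thesis
        using \<open>r \<noteq> 0\<close> by auto
    qed
    then have "UNIV - {0} \<subseteq> (\<lambda>i. \<alpha> ^ i) ` {..<r}"
      using assms unfolding primitive_element_def by (metis image_subsetI)
    then have "card (UNIV - {0 :: 'a}) \<le> card {..<r}"
      by (meson card_image_le card_mono finite_imageI finite_lessThan le_trans)
    then show False
      using r(2) by (simp add: card_Diff_singleton)
  qed
  then show "CARD('a) - 1 dvd i"
    by (auto simp: r_def)
qed

text \<open>Orthogonality of characters with values in the field: substituting
  \<open>\<alpha> * x\<close> for \<open>x\<close> multiplies the sum by
  \<open>\<alpha> ^ k\<close>, so it vanishes unless that factor is 1.\<close>

lemma sum_powers_nonzero:
  fixes \<alpha> :: "'a::{field, finite}"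
  assumes "primitive_element \<alpha>" and "of_nat (CARD('a)) = (0 :: 'a)"
  shows "(\<Sum>x\<in>UNIV - {0 :: 'a}. x ^ k) = (if CARD('a) - 1 dvd k then -1 else 0)"
proof (cases "CARD('a) - 1 dvd k")
  case True
  then have "(\<Sum>x\<in>UNIV - {0 :: 'a}. x ^ k) = (\<Sum>x\<in>UNIV - {0 :: 'a}. 1)"
    by (intro sum.cong) (auto simp: power_mult power_card_minus_1_eq_1 simp del: One_nat_def)
  also have "\<dots> = of_nat (CARD('a) - 1)"
    by (simp add: card_Diff_singleton)
  also have "\<dots> = - 1"
    using assms(2) card_field_ge_2[where 'a = 'a] by (subst of_nat_diff) auto
  finally show ?thesis
    using True by simp
next
  case False
  note nz = primitive_element_nonzero[OF assms(1)]
  have "\<alpha> ^ k * (\<Sum>x\<in>UNIV - {0 :: 'a}. x ^ k) = (\<Sum>x\<in>UNIV - {0 :: 'a}. (\<alpha> * x) ^ k)"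
    by (simp add: sum_distrib_left power_mult_distrib)
  also have "\<dots> = (\<Sum>x\<in>UNIV - {0 :: 'a}. x ^ k)"
    by (rule sum.reindex_bij_witness[of _ "\<lambda>y. y / \<alpha>" "\<lambda>y. \<alpha> * y"]) (use nz in auto)
  finally have "(\<alpha> ^ k - 1) * (\<Sum>x\<in>UNIV - {0 :: 'a}. x ^ k) = 0"
    by (simp add: algebra_simps)
  then show ?thesis
    using False primitive_element_power_eq_1_iff[OF assms(1)] by auto
qed

text \<open>Raising to an inverse \<open>u\<close> of \<open>t\<close> modulo q - 1 undoes the
  \<open>t\<close>-th power.\<close>

lemma coprime_power_bij_nonzero:
  fixes b :: "'a::{field, finite}"
  assumes "coprime t (CARD('a) - 1)" and "b \<noteq> 0"
  shows "bij_betw (\<lambda>x. b * x ^ t) (UNIV - {0}) (UNIV - {0})"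
proof -
  obtain u where u: "[t * u = 1] (mod (CARD('a) - 1))"
    using cong_solve_coprime_nat[OF assms(1)] by auto
  have pow: "(x ^ t) ^ u = x" if "x \<noteq> 0" for x :: 'a
  proof -
    have "(x ^ t) ^ u = x ^ (t * u mod (CARD('a) - 1))"
      by (simp add: power_mult power_mod_card_minus_1[OF that] del: One_nat_def)
    also have "\<dots> = x ^ 1"
      using u that unfolding cong_def by (metis power_mod_card_minus_1)
    finally show ?thesis by simp
  qed
  have inj: "inj_on (\<lambda>x. b * x ^ t) (UNIV - {0})"
    by (rule inj_onI) (metis assms(2) DiffD2 insertI1 mult_left_cancel pow)
  moreover have "(\<lambda>x. b * x ^ t) ` (UNIV - {0}) = UNIV - {0}"
    by (rule endo_inj_surj[OF _ _ inj]) (use assms(2) in auto)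
  ultimately show ?thesis
    by (simp add: bij_betw_def)
qed

section \<open>A Fourier transform of the SLCE sequence\<close>

text \<open>The signs lie in the field itself, so that Fourier coefficients reduce to power sums
  there. The value 1 at x = -1 matches the entry 0 of the sequence in that case.\<close>

definition slce_sign :: "'a::{field, finite} \<Rightarrow> 'a"
  where "slce_sign x = (if x + 1 = 0 \<or> is_square (x + 1) then 1 else -1)"

text \<open>Up to the sign \<open>(-1) ^ (l + 1)\<close>, this is the coefficient of \<open>x ^ l\<close> in the polynomial of degree
  less than \<open>q - 1\<close> that represents \<^const>\<open>slce_sign\<close> on the nonzero elements.\<close>

definition slce_coeff :: "'a::{field, finite} itself \<Rightarrow> nat \<Rightarrow> 'a"
  where "slce_coeff _ l = (-1) ^ l * (\<Sum>x\<in>UNIV - {0}. slce_sign x * inverse x ^ l)"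

section \<open>Fourier coefficients over a prime field\<close>

locale slce_prime_field =
  fixes \<alpha> :: "'a::{field, finite}" and m :: nat
  assumes prim: "primitive_element \<alpha>"
    and card: "CARD('a) = 2 * m + 1"
    and prime: "prime (2 * m + 1)"
begin

lemma m_pos: "m > 0"
  using prime by (cases m) auto

lemma alpha_nonzero: "\<alpha> \<noteq> 0"
  by (rule primitive_element_nonzero[OF prim])

lemma power_2m_eq_1: "x ^ (2 * m) = 1" if "x \<noteq> 0" for x :: 'a
  using power_card_minus_1_eq_1[OF that] card by simp

lemma of_nat_eq_0_iff_dvd: "of_nat k = (0 :: 'a) \<longleftrightarrow> 2 * m + 1 dvd k"
proof -
  have "CHAR('a) dvd 2 * m + 1"
    using CHAR_dvd_CARD[where 'a = 'a] card by simp
  then have "CHAR('a) = 2 * m + 1"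
    using prime CHAR_not_1[where 'a = 'a] unfolding prime_nat_iff by auto
  then show ?thesis
    by (simp add: of_nat_eq_0_iff_char_dvd)
qed

lemma numeral_eq_0_iff_dvd: "numeral k = (0 :: 'a) \<longleftrightarrow> 2 * m + 1 dvd numeral k"
  using of_nat_eq_0_iff_dvd[of "numeral k"] by simp

lemma two_neq_0: "(2 :: 'a) \<noteq> 0"
  unfolding numeral_eq_0_iff_dvd using m_pos by (auto dest: dvd_imp_le)

lemma two_m: "2 * of_nat m = (-1 :: 'a)"
proof -
  have "of_nat (2 * m + 1) = (0 :: 'a)"
    unfolding of_nat_eq_0_iff_dvd by simp
  then show ?thesis
    by (simp add: eq_neg_iff_add_eq_0 add.commute)
qed

lemma alpha_power_m: "\<alpha> ^ m = -1"
proof -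
  have "(\<alpha> ^ m)\<^sup>2 = 1"
    using power_2m_eq_1[OF alpha_nonzero] by (simp add: mult.commute flip: power_mult)
  moreover have "\<alpha> ^ m \<noteq> 1"
    using m_pos by (auto simp: primitive_element_power_eq_1_iff[OF prim] card dest: dvd_imp_le)
  ultimately show ?thesis
    by (simp add: power2_eq_1_iff)
qed

text \<open>Euler's criterion for \<open>x + 1\<close>; the extra summand corrects the value 0 of
  the power at x = -1.\<close>

lemma slce_sign_eq: "slce_sign x = (x + 1) ^ m + (if x = -1 then 1 else 0)" for x :: 'a
proof (cases "x = -1")
  case True
  then show ?thesis
    using m_pos by (simp add: slce_sign_def)
next
  case False
  define z where "z = x + 1"
  have "z \<noteq> 0"
    using False by (simp add: z_def eq_neg_iff_add_eq_0)
  then obtain i where i: "z = \<alpha> ^ i"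
    using prim unfolding primitive_element_def by blast
  have zm: "z ^ m = (-1) ^ i"
    unfolding i power_mult[symmetric] by (simp add: mult.commute[of i] power_mult alpha_power_m)
  have "is_square z \<longleftrightarrow> even i"
  proof
    assume "is_square z"
    then obtain w where w: "z = w\<^sup>2"
      by (auto elim: is_nth_powerE)
    with \<open>z \<noteq> 0\<close> have "z ^ m = 1"
      using power_2m_eq_1[of w] by (simp flip: power_mult)
    then show "even i"
      using zm two_neq_0 by (cases "even i") auto
  next
    assume "even i"
    then obtain k where "i = 2 * k" by blast
    then show "is_square z"
      by (simp add: i mult.commute[of 2] power_mult)
  qed
  then show ?thesis
    using False \<open>z \<noteq> 0\<close> zm by (auto simp: slce_sign_def z_def)
qed

text \<open>After binomial expansion of \<open>(x + 1) ^ m\<close>, orthogonality keeps only the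
  term of degree \<open>l\<close>; the correction at x = -1 contributes the summand 1.\<close>

lemma slce_coeff_eq:
  assumes "l < 2 * m"
  shows "slce_coeff TYPE('a) l = 1 - (-1) ^ l * of_nat (m choose l)"
proof -
  have inv: "inverse x ^ l = x ^ (2 * m - l)" if "x \<noteq> 0" for x :: 'a
  proof -
    have "x ^ l * x ^ (2 * m - l) = 1"
      using assms power_2m_eq_1[OF that] by (simp flip: power_add)
    then show ?thesis
      using that by (simp add: power_inverse field_simps)
  qed
  \<comment> \<open>The exponent lies strictly between 0 and 4m, so the only multiple of 2m it can
    equal is 2m itself.\<close>
  have dvd: "2 * m dvd i + (2 * m - l) \<longleftrightarrow> i = l" if "i \<le> m" for i
  proof
    assume "2 * m dvd i + (2 * m - l)"
    then obtain k where k: "i + (2 * m - l) = 2 * m * k"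
      by blast
    moreover have "i + (2 * m - l) > 2 * m * 0" "i + (2 * m - l) < 2 * m * 2"
      using assms that m_pos by auto
    ultimately have "k > 0" "k < 2"
      by (auto simp del: mult_0_right)
    then have "k = 1" by simp
    then show "i = l"
      using k assms by auto
  qed (use assms in auto)
  have "(\<Sum>x\<in>UNIV - {0 :: 'a}. (x + 1) ^ m * inverse x ^ l)
      = (\<Sum>x\<in>UNIV - {0 :: 'a}. \<Sum>i\<le>m. of_nat (m choose i) * x ^ (i + (2 * m - l)))"
    by (intro sum.cong refl) (simp add: binomial_ring sum_distrib_right inv power_add mult.assoc)
  also have "\<dots> = (\<Sum>i\<le>m. of_nat (m choose i) * (\<Sum>x\<in>UNIV - {0 :: 'a}. x ^ (i + (2 * m - l))))"
    by (subst sum.swap) (simp add: sum_distrib_left)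
  also have "\<dots> = (\<Sum>i\<le>m. if i = l then - of_nat (m choose i) else 0)"
  proof (intro sum.cong refl)
    fix i assume "i \<in> {..m}"
    then have i: "i \<le> m" by simp
    have "of_nat (CARD('a)) = (0 :: 'a)"
      by (simp add: of_nat_eq_0_iff_dvd card del: of_nat_Suc of_nat_add of_nat_mult)
    from sum_powers_nonzero[OF prim this] dvd[OF i]
    show "of_nat (m choose i) * (\<Sum>x\<in>UNIV - {0 :: 'a}. x ^ (i + (2 * m - l)))
      = (if i = l then - of_nat (m choose i) else 0)"
      by (simp add: card)
  qed
  also have "\<dots> = - of_nat (m choose l)"
    by (auto simp: sum.delta not_le binomial_eq_0)
  finally have 1: "(\<Sum>x\<in>UNIV - {0 :: 'a}. (x + 1) ^ m * inverse x ^ l) = - of_nat (m choose l)" .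
  have "(\<Sum>x\<in>UNIV - {0 :: 'a}. (if x = -1 then 1 else 0) * inverse x ^ l)
      = (\<Sum>x\<in>UNIV - {0 :: 'a}. if x = -1 then inverse x ^ l else 0)"
    by (intro sum.cong) auto
  also have "\<dots> = (-1) ^ l"
    by (simp add: sum.delta)
  finally have 2: "(\<Sum>x\<in>UNIV - {0 :: 'a}. (if x = -1 then 1 else 0) * inverse x ^ l) = (-1) ^ l" .
  have "slce_coeff TYPE('a) l = (-1) ^ l * (- of_nat (m choose l) + (-1) ^ l)"
    unfolding slce_coeff_def slce_sign_eq distrib_right sum.distrib 1 2 ..
  moreover have "(-1) ^ l * (-1) ^ l = (1 :: 'a)"
    by (simp flip: power_mult_distrib)
  ultimately show ?thesis
    by (simp add: right_diff_distrib)
qed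

lemma slce_coeff_mod: "slce_coeff TYPE('a) (l mod (2 * m)) = slce_coeff TYPE('a) l"
proof -
  have "x ^ (l mod (2 * m)) = x ^ l" if "x \<noteq> 0" for x :: 'a
    using power_mod_card_minus_1[OF that, of l] card by simp
  then show ?thesis
    by (simp add: slce_coeff_def)
qed

lemma slce_coeff_cong:
  "[l = k] (mod (2 * m)) \<Longrightarrow> slce_coeff TYPE('a) l = slce_coeff TYPE('a) k"
  unfolding cong_def by (metis slce_coeff_mod)

text \<open>Substitute the permutation \<open>b * x ^ t\<close> for \<open>x\<close> in the sum. The
  sign in front is unaffected because \<open>t\<close>, being coprime to 2m, is odd.\<close>

lemma slce_coeff_times:
  assumes t: "coprime t (2 * m)" and b: "b \<noteq> 0"
    and sign: "\<And>x :: 'a. x \<noteq> 0 \<Longrightarrow> slce_sign (b * x ^ t) = slce_sign x"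
  shows "slce_coeff TYPE('a) (t * l) = b ^ l * slce_coeff TYPE('a) l"
proof -
  have "(\<Sum>x\<in>UNIV - {0}. slce_sign x * inverse x ^ l)
      = (\<Sum>x\<in>UNIV - {0}. slce_sign (b * x ^ t) * inverse (b * x ^ t) ^ l)"
    by (rule sum.reindex_bij_betw[symmetric, OF coprime_power_bij_nonzero]) (use t b card in auto)
  also have "\<dots> = (\<Sum>x\<in>UNIV - {0}. inverse b ^ l * (slce_sign x * inverse x ^ (t * l)))"
    by (intro sum.cong refl)
      (simp add: sign power_mult_distrib power_mult inverse_mult_distrib power_inverse)
  finally have "b ^ l * (\<Sum>x\<in>UNIV - {0}. slce_sign x * inverse x ^ l)
      = (\<Sum>x\<in>UNIV - {0}. slce_sign x * inverse x ^ (t * l))"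
    using b by (simp add: sum_distrib_left[symmetric] power_inverse)
  moreover have "odd t"
    using t by auto
  ultimately show ?thesis
    by (simp add: slce_coeff_def power_mult)
qed

text \<open>For l \<le> m the binomial coefficient divides \<open>fact m\<close>, hence is prime to
  2m + 1; for larger \<open>l\<close> it is 0.\<close>

lemma slce_coeff_eq_1_iff:
  assumes "l < 2 * m"
  shows "slce_coeff TYPE('a) l = 1 \<longleftrightarrow> m < l"
proof -
  have "\<not> 2 * m + 1 dvd m choose l" if "l \<le> m"
  proof
    assume "2 * m + 1 dvd m choose l"
    also have "(m choose l) dvd fact m"
      using binomial_fact_lemma[OF that] by (metis dvd_triv_right)
    finally show False
      using prime by (simp add: prime_dvd_fact_iff)
  qed
  then show ?thesis
    by (cases "l \<le> m")
      (auto simp: slce_coeff_eq[OF assms] of_nat_eq_0_iff_dvd binomial_eq_0)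
qed

lemma slce_coeff_1:
  assumes "m > 1"
  shows "2 * slce_coeff TYPE('a) 1 = 1"
  using assms two_m by (simp add: slce_coeff_eq distrib_left)

lemma slce_coeff_2:
  assumes "m > 1"
  shows "8 * slce_coeff TYPE('a) 2 = 5"
proof -
  have "2 * (m choose 2) = m * (m - 1)"
    by (cases m) (simp_all add: choose_two)
  then have "of_nat (2 * (m choose 2)) = (of_nat (m * (m - 1)) :: 'a)"
    by simp
  then have "2 * of_nat (m choose 2) = (of_nat m * (of_nat m - 1) :: 'a)"
    using m_pos by (simp add: of_nat_diff)
  \<comment> \<open>The factor 4 lets \<open>m\<close> occur only through 2m = -1, which turns the
    right-hand side into (-1)(-3) = 3.\<close>
  then have "4 * (2 * of_nat (m choose 2)) = (4 * (of_nat m * (of_nat m - 1)) :: 'a)"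
    by (rule arg_cong)
  also have "\<dots> = 2 * of_nat m * (2 * of_nat m - 2)"
    by (simp add: algebra_simps)
  finally have "4 * (2 * of_nat (m choose 2)) = (2 * of_nat m * (2 * of_nat m - 2) :: 'a)" .
  then have "8 * of_nat (m choose 2) = (3 :: 'a)"
    by (simp add: two_m)
  then show ?thesis
    using assms by (simp add: slce_coeff_eq right_diff_distrib)
qed

section \<open>Rigidity of the sign function\<close>

lemma slce_sign_invariant_imp_cong_1:
  assumes m: "m \<noteq> 2"
    and t: "coprime t (2 * m)" and b: "b \<noteq> 0"
    and sign: "\<And>x :: 'a. x \<noteq> 0 \<Longrightarrow> slce_sign (b * x ^ t) = slce_sign x"
  shows "[t = 1] (mod (2 * m))"
proof (cases "m = 1")
  case True
  then show ?thesis
    using t by (simp add: cong_def odd_iff_mod_2_eq_one)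
next
  case False
  then have m: "m > 2"
    using m m_pos by simp
  define d where "d = slce_coeff TYPE('a)"
  define s where "s = t mod (2 * m)"
  have s: "s < 2 * m" "[t = s] (mod (2 * m))"
    using m by (auto simp: s_def cong_def)
  have "coprime s (2 * m)"
    by (rule cong_imp_coprime[OF s(2) t])
  have "s \<noteq> 0" "s \<noteq> m"
    using \<open>coprime s (2 * m)\<close> m by (auto intro: odd_pos)
  have d_times: "d k = b ^ l * d l" if "[s * l = k] (mod (2 * m))" for k l
  proof -
    have "[k = t * l] (mod (2 * m))"
      using that s(2) by (meson cong_scalar_right cong_sym cong_trans)
    then have "d k = d (t * l)"
      unfolding d_def by (rule slce_coeff_cong)
    also have "d (t * l) = b ^ l * d l"
      unfolding d_def by (rule slce_coeff_times[OF t b]) (rule sign)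
    finally show ?thesis .
  qed
  have d_eq_1: "d k = 1 \<longleftrightarrow> m < k" if "k < 2 * m" for k
    unfolding d_def by (rule slce_coeff_eq_1_iff[OF that])
  \<comment> \<open>Negation modulo 2m, written with complements to stay in the natural
    numbers.\<close>
  have neg: "[s * (2 * m - l) = 2 * m - k] (mod (2 * m))"
    if "[s * l = k] (mod (2 * m))" "l \<le> 2 * m" "k \<le> 2 * m" for k l
  proof -
    have "[int s * (2 * int m - int l) = 2 * int m - int k] (mod (2 * int m))"
      using that(1) by (auto simp: cong_iff_dvd_diff algebra_simps simp flip: cong_int_iff)
    then show ?thesis
      using that by (simp flip: cong_int_iff add: of_nat_diff)
  qed
  have b_n: "b ^ (2 * m) = 1"
    by (rule power_2m_eq_1[OF b])
  have "s = 1"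
  proof (rule ccontr)
    assume "s \<noteq> 1"
    consider "s < m" | "m < s"
      using \<open>s \<noteq> m\<close> by linarith
    then show False
    proof cases
      case 1
      \<comment> \<open>Index -1: both complements exceed \<open>m\<close>, so both coefficients are
        1 and only the power of \<open>b\<close> remains.\<close>
      have "d (2 * m - s) = b ^ (2 * m - 1) * d (2 * m - 1)"
        by (rule d_times, rule neg) (use s m in auto)
      moreover have "d (2 * m - s) = 1" "d (2 * m - 1) = 1"
        using 1 \<open>s \<noteq> 0\<close> m by (subst d_eq_1; simp)+
      ultimately have "b ^ (2 * m - 1) = 1"
        by simp
      moreover have "b ^ (2 * m) = b * b ^ (2 * m - 1)"
        using m by (simp flip: power_Suc)
      ultimately have "b = 1"
        using b_n by simp
      \<comment> \<open>The first multiple of \<open>s\<close> beyond \<open>m\<close> is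
        \<open>s * k\<close>; it is at most m + s < 2m. As s \<ge> 2 and m > 2, \<open>k\<close>
        itself stays within \<open>m\<close>.\<close>
      define k where "k = m div s + 1"
      have "m div s \<le> m div 2"
        using \<open>s \<noteq> 0\<close> \<open>s \<noteq> 1\<close> by (intro div_le_mono2) auto
      then have "k \<le> m"
        using m by (simp add: k_def)
      have "s * (m div s) + m mod s = m" "m mod s < s"
        using \<open>s \<noteq> 0\<close> by auto
      moreover have "s * k = s * (m div s) + s"
        by (simp add: k_def)
      ultimately have "m < s * k" "s * k < 2 * m"
        using 1 by linarith+
      moreover have "d (s * k) = d k"
        using d_times[of k "s * k"] \<open>b = 1\<close> by simp
      ultimately show False
        using d_eq_1[of k] d_eq_1[of "s * k"] \<open>k \<le> m\<close> m by auto
    next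
      case 2
      have d_1: "2 * d 1 = 1" and d_2: "8 * d 2 = 5"
        using slce_coeff_1 slce_coeff_2 m by (simp_all add: d_def)
      have "1 = b * d 1"
        using d_times[of 1 s] d_eq_1[OF s(1)] 2 by simp
      then have "b * (2 * d 1) = 2"
        by (metis mult.left_commute mult.right_neutral)
      then have "b = 2"
        unfolding d_1 by simp
      \<comment> \<open>The residue of 2s, since m < s < 2m.\<close>
      define r where "r = 2 * s - 2 * m"
      have r: "r < 2 * m" "r > 0"
        using 2 s(1) by (auto simp: r_def)
      have r_cong: "[s * 2 = r] (mod (2 * m))"
      proof -
        have "s * 2 = r + 2 * m"
          using 2 by (simp add: r_def)
        then show ?thesis
          by (simp add: cong_def)
      qed
      \<comment> \<open>The three contradictions below are 2 = 5, 4 = 1 and 1 = 10, whose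
        differences 3, 3 and 9 are nonzero once 3 is.\<close>
      have "(3 :: 'a) \<noteq> 0"
        unfolding numeral_eq_0_iff_dvd using m by (auto dest: dvd_imp_le)
      then have "(5 :: 'a) - 2 \<noteq> 0" "(4 :: 'a) - 1 \<noteq> 0" "(10 :: 'a) - 1 \<noteq> 0"
        using mult_eq_0_iff[of "3 :: 'a" 3] by simp_all
      then have neq: "(2 :: 'a) \<noteq> 5" "(4 :: 'a) \<noteq> 1" "(1 :: 'a) \<noteq> 10"
        by force+
      have "d r = b\<^sup>2 * d 2"
        by (rule d_times[OF r_cong])
      then have "2 * d r = 8 * d 2"
        using \<open>b = 2\<close> by simp
      then have dr: "2 * d r = 5"
        using d_2 by simp
      \<comment> \<open>Index -2: since m > 2, the index 2m - 2 exceeds \<open>m\<close> and has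
        coefficient 1. For m = 2 it would equal \<open>m\<close>.\<close>
      have "d (2 * m - r) = b ^ (2 * m - 2) * d (2 * m - 2)"
        by (rule d_times, rule neg) (use r_cong r m in auto)
      moreover have "d (2 * m - 2) = 1"
        using m by (simp add: d_eq_1)
      moreover have "b ^ (2 * m) = b ^ 2 * b ^ (2 * m - 2)"
      proof -
        have "2 * m = 2 + (2 * m - 2)"
          using m by simp
        then show ?thesis
          by (metis power_add)
      qed
      ultimately have dr': "4 * d (2 * m - r) = 1"
        using b_n \<open>b = 2\<close> by simp
      consider "m < r" | "m < 2 * m - r" | "r = m"
        by linarith
      then show False
      proof cases
        case 1
        then show False
          using d_eq_1[of r] r dr neq by simp
      next
        case 2
        then have "d (2 * m - r) = 1"
          using d_eq_1[of "2 * m - r"] r by simp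
        then show False
          using dr' neq by simp
      next
        case 3
        then have "1 = 2 * (2 * d r)"
          using dr' by simp
        then show False
          using neq unfolding dr by simp
      qed
    qed
  qed
  then show ?thesis
    using s(2) by simp
qed

section \<open>Back to the sequence\<close>

lemma slce_seq_eq_iff:
  "slce_seq \<alpha> i = slce_seq \<alpha> j \<longleftrightarrow> slce_sign (\<alpha> ^ i) = slce_sign (\<alpha> ^ j)"
proof -
  have "(-1 :: 'a) \<noteq> 1"
    using two_neq_0 by (metis add_neg_numeral_special(8) one_add_one)
  then show ?thesis
    unfolding slce_seq_def slce_sign_def Let_def power_mod_card_minus_1[OF alpha_nonzero]
    by auto
qed

lemma slce_seq_mod: "slce_seq \<alpha> (i mod (2 * m)) = slce_seq \<alpha> i"
  by (simp add: slce_seq_def card)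

lemma slce_seq_cong: "[i = j] (mod (2 * m)) \<Longrightarrow> slce_seq \<alpha> i = slce_seq \<alpha> j"
  unfolding cong_def by (metis slce_seq_mod)

text \<open>Under \<open>x = \<alpha> ^ i\<close>, the affine map of indices becomes the map
  \<open>b * x ^ t\<close> with \<open>b = \<alpha> ^ c\<close>.\<close>

lemma slce_seq_affine_imp_cong_1:
  assumes m: "m \<noteq> 2" and t: "coprime t (2 * m)"
    and seq: "\<And>i. slce_seq \<alpha> (t * i + c) = slce_seq \<alpha> i"
  shows "[t = 1] (mod (2 * m))"
proof (rule slce_sign_invariant_imp_cong_1[OF m t, of "\<alpha> ^ c"])
  fix x :: 'a assume "x \<noteq> 0"
  then obtain i where i: "x = \<alpha> ^ i"
    using prim unfolding primitive_element_def by blast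
  have "\<alpha> ^ c * x ^ t = \<alpha> ^ (t * i + c)"
    by (simp add: i mult.commute power_add flip: power_mult)
  then show "slce_sign (\<alpha> ^ c * x ^ t) = slce_sign x"
    using seq[of i] unfolding slce_seq_eq_iff i by simp
qed (simp add: alpha_nonzero)

lemma slce_ads_mem_iff:
  "int (i mod (2 * m)) \<in> slce_ads \<alpha> \<longleftrightarrow> slce_seq \<alpha> i = 1"
proof -
  have "int (i mod (2 * m)) < 2 * int m"
    using m_pos by (simp add: zmod_int)
  then show ?thesis
    by (simp add: slce_ads_def residue_ring_def card slce_seq_mod)
qed

section \<open>The multiplier group\<close>

sublocale R: residues "int (2 * m)" "residue_ring (int (2 * m))"
  using m_pos by unfold_locales auto

lemma slce_seq_eq_0_or_1: "slce_seq \<alpha> i = 0 \<or> slce_seq \<alpha> i = 1"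
  by (simp add: slce_seq_def Let_def)

lemma multipliers_slce_ads:
  assumes "m \<noteq> 2"
  shows "multipliers (2 * m) (slce_ads \<alpha>) = {1}"
proof -
  have "t = 1" if mult: "t \<in> multipliers (2 * m) (slce_ads \<alpha>)" for t
  proof -
    obtain c where t: "0 < t" "t < int (2 * m)" "coprime t (int (2 * m))"
      and c: "0 \<le> c" "c < int (2 * m)"
      and im: "(\<lambda>j. t * j mod int (2 * m)) ` slce_ads \<alpha> = (\<lambda>j. (j + c) mod int (2 * m)) ` slce_ads \<alpha>"
      using mult unfolding multipliers_def Let_def R.res_units_eq R.res_mult_eq R.res_add_eq
        R.res_carrier_eq mem_Collect_eq Bex_def atLeastAtMost_iff zle_diff1_eq by blast
    have S: "j \<in> slce_ads \<alpha> \<Longrightarrow> 0 \<le> j \<and> j < int (2 * m)" for j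
      by (simp add: slce_ads_def residue_ring_def card)
    \<comment> \<open>A natural number representing -c: the relation tS = S + c says that
      \<open>i\<close> lies in S exactly when t i - c does.\<close>
    define e where "e = nat (int (2 * m) - c)"
    have e: "int e = int (2 * m) - c"
      using c by (simp add: e_def)
    have "slce_seq \<alpha> (nat t * i + e) = 1 \<longleftrightarrow> slce_seq \<alpha> i = 1" for i
    proof
      assume "slce_seq \<alpha> i = 1"
      then have "t * int (i mod (2 * m)) mod int (2 * m) \<in> (\<lambda>j. (j + c) mod int (2 * m)) ` slce_ads \<alpha>"
        using slce_ads_mem_iff[of i] im by blast
      then obtain j where j: "j \<in> slce_ads \<alpha>" "[t * int i = j + c] (mod int (2 * m))"
        by (auto simp: cong_def zmod_int mod_mult_right_eq)
      have "[t * int i + int e = j + c + int e] (mod int (2 * m))"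
        using j(2) by (rule cong_add) simp
      then have "[int (nat t * i + e) = int (nat j)] (mod int (2 * m))"
        using S[OF j(1)] t(1) by (simp add: e cong_def)
      then have "(nat t * i + e) mod (2 * m) = nat j"
        using S[OF j(1)] unfolding cong_int_iff by (simp add: cong_def nat_less_iff)
      then show "slce_seq \<alpha> (nat t * i + e) = 1"
        using slce_ads_mem_iff[of "nat t * i + e"] j(1) S[OF j(1)] by simp
    next
      assume *: "slce_seq \<alpha> (nat t * i + e) = 1"
      define j where "j = int ((nat t * i + e) mod (2 * m))"
      have "j \<in> slce_ads \<alpha>"
        using * slce_ads_mem_iff by (simp add: j_def)
      then obtain k where k: "k \<in> slce_ads \<alpha>" "[t * k = j + c] (mod int (2 * m))"
        using im by (force simp: cong_def)
      have "[j + c = t * int i] (mod int (2 * m))"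
        using t(1) e by (simp add: j_def zmod_int cong_def mod_simps)
      then have "[t * k = t * int i] (mod int (2 * m))"
        using k(2) cong_trans by blast
      \<comment> \<open>The unit \<open>t\<close> cancels, which identifies the preimage
        \<open>k\<close> with the class of \<open>i\<close>.\<close>
      then have "[k = int i] (mod int (2 * m))"
        using t(3) by (simp add: cong_mult_lcancel)
      then have "k = int (i mod (2 * m))"
        using S[OF k(1)] by (simp add: cong_def zmod_int)
      then show "slce_seq \<alpha> i = 1"
        using k(1) slce_ads_mem_iff by simp
    qed
    then have "slce_seq \<alpha> (nat t * i + e) = slce_seq \<alpha> i" for i
      using slce_seq_eq_0_or_1 by metis
    moreover have "coprime (nat t) (2 * m)"
      using t by (simp flip: coprime_int_iff)
    ultimately have "[nat t = 1] (mod (2 * m))"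
      using slce_seq_affine_imp_cong_1[OF assms] by blast
    then show "t = 1"
      using t m_pos by (simp add: cong_def nat_less_iff)
  qed
  moreover have "1 \<in> multipliers (2 * m) (slce_ads \<alpha>)"
    unfolding multipliers_def Let_def R.res_units_eq R.res_mult_eq R.res_add_eq R.res_carrier_eq
    using m_pos by (auto intro!: bexI[of _ 0])
  ultimately show ?thesis
    by blast
qed

section \<open>Shift-inequivalence of the decimations\<close>

lemma least_pos_rep_cong: "[int (least_pos_rep (2 * m) t) = t] (mod int (2 * m))"
proof -
  \<comment> \<open>Adding the modulus keeps the witness positive even for the zero class.\<close>
  have "nat (t mod int (2 * m)) + 2 * m > 0
      \<and> [int (nat (t mod int (2 * m)) + 2 * m) = t] (mod int (2 * m))"
    using m_pos by (simp add: cong_def)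
  then show ?thesis
    unfolding least_pos_rep_def by (rule LeastI2) blast
qed

text \<open>Replacing \<open>i\<close> by \<open>v * i\<close>, with \<open>v\<close> inverse to
  \<open>t'\<close>, turns a shift-equivalence into invariance of the sequence under an affine map
  with multiplier \<open>u' * v\<close>, which must then be 1 modulo 2m.\<close>

lemma shift_equivalent_decimations_imp_eq:
  assumes m: "m \<noteq> 2"
    and t: "t \<in> Units (residue_ring (int (2 * m)))" and u: "u \<in> Units (residue_ring (int (2 * m)))"
    and eq: "shift_equivalent (2 * m) (decimation (slce_seq \<alpha>) (least_pos_rep (2 * m) t))
      (decimation (slce_seq \<alpha>) (least_pos_rep (2 * m) u))"
  shows "t = u"
proof -
  define t' u' where "t' = least_pos_rep (2 * m) t" and "u' = least_pos_rep (2 * m) u"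
  have t': "[int t' = t] (mod int (2 * m))" and u': "[int u' = u] (mod int (2 * m))"
    by (simp_all only: t'_def u'_def least_pos_rep_cong)
  have "coprime t (int (2 * m))" "coprime u (int (2 * m))"
    using t u by (simp_all only: R.res_units_eq mem_Collect_eq)
  then have "coprime (int t') (int (2 * m))" "coprime (int u') (int (2 * m))"
    using t' u' by (metis cong_imp_coprime cong_sym)+
  then have coprime: "coprime t' (2 * m)" "coprime u' (2 * m)"
    by (simp_all only: coprime_int_iff)
  obtain l where l: "\<And>i. slce_seq \<alpha> (t' * i) = slce_seq \<alpha> (u' * nat ((int i + l) mod int (2 * m)))"
    using eq unfolding shift_equivalent_def decimation_def t'_def u'_def by blast
  obtain v where v: "[t' * v = 1] (mod (2 * m))"
    using cong_solve_coprime_nat[OF coprime(1)] by auto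
  define c where "c = nat (l mod int (2 * m))"
  have c: "[int c = l] (mod int (2 * m))"
    using m_pos by (simp add: c_def cong_def)
  have "slce_seq \<alpha> (u' * v * i + u' * c) = slce_seq \<alpha> i" for i
  proof -
    have "[nat ((int (v * i) + l) mod int (2 * m)) = v * i + c] (mod (2 * m))"
      unfolding cong_int_iff[symmetric]
      using m_pos c by (simp add: cong_def) (metis mod_add_right_eq)
    then have "[u' * nat ((int (v * i) + l) mod int (2 * m)) = u' * v * i + u' * c] (mod (2 * m))"
      using cong_scalar_left by (metis distrib_left mult.assoc)
    then have "slce_seq \<alpha> (u' * v * i + u' * c) = slce_seq \<alpha> (t' * (v * i))"
      unfolding l by (metis slce_seq_cong)
    moreover have "[t' * (v * i) = i] (mod (2 * m))"
      using cong_scalar_right[OF v, of i] by (simp add: mult.assoc)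
    ultimately show ?thesis
      using slce_seq_cong by metis
  qed
  moreover have "coprime v (2 * m)"
    using v by (metis coprime_iff_invertible_nat mult.commute One_nat_def)
  ultimately have "[u' * v = 1] (mod (2 * m))"
    using slce_seq_affine_imp_cong_1[OF m] coprime(2) by (metis coprime_mult_left_iff)
  then have "[t' * v = u' * v] (mod (2 * m))"
    using v by (metis cong_sym cong_trans)
  then have "[t' = u'] (mod (2 * m))"
    using \<open>coprime v (2 * m)\<close> by (metis cong_mult_rcancel_nat)
  then have "[t = u] (mod int (2 * m))"
    using t' u' by (metis cong_int_iff cong_sym cong_trans)
  moreover have "0 < t" "t < int (2 * m)" "0 < u" "u < int (2 * m)"
    using t u by (simp_all only: R.res_units_eq mem_Collect_eq)
  ultimately show "t = u"
    by (simp add: cong_def)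
qed

text \<open>Needed for the cardinality: equal decimations are shift-equivalent, so they come from
  the same unit. Even the shift 0 reduces the index, so periodicity enters.\<close>

lemma shift_equivalent_refl:
  "shift_equivalent (2 * m) (decimation (slce_seq \<alpha>) t) (decimation (slce_seq \<alpha>) t)"
  unfolding shift_equivalent_def decimation_def
proof (intro exI[of _ 0] allI slce_seq_cong)
  fix i
  have "[i = i mod (2 * m)] (mod (2 * m))"
    by (simp add: cong_def)
  moreover have "nat ((int i + 0) mod int (2 * m)) = i mod (2 * m)"
    by (simp only: add_0_right nat_int flip: zmod_int)
  ultimately show "[t * i = t * nat ((int i + 0) mod int (2 * m))] (mod (2 * m))"
    using cong_scalar_left by metis
qed

lemma slce_family_inequivalent:
  assumes "m \<noteq> 2"
  shows "card (slce_family \<alpha>) = totient (2 * m)"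
    and "pairwise (\<lambda>a b. \<not> shift_equivalent (2 * m) a b) (slce_family \<alpha>)"
proof -
  have fam: "slce_family \<alpha> = (\<lambda>t. decimation (slce_seq \<alpha>) (least_pos_rep (2 * m) t)) `
      Units (residue_ring (int (2 * m)))"
    by (simp add: slce_family_def card)
  have "inj_on (\<lambda>t. decimation (slce_seq \<alpha>) (least_pos_rep (2 * m) t))
      (Units (residue_ring (int (2 * m))))"
    by (rule inj_onI) (metis shift_equivalent_decimations_imp_eq[OF assms] shift_equivalent_refl)
  then show "card (slce_family \<alpha>) = totient (2 * m)"
    unfolding fam using R.totient_eq by (simp only: card_image nat_int)
  show "pairwise (\<lambda>a b. \<not> shift_equivalent (2 * m) a b) (slce_family \<alpha>)"
    unfolding fam pairwise_def using shift_equivalent_decimations_imp_eq[OF assms] by blast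
qed

end

theorem theorem4p3:
  fixes \<alpha> :: "'a::{field, finite}" and p :: nat
  assumes "prime p" and "odd p" and "p \<noteq> 5"
    and "CARD('a) = p"
    and "primitive_element \<alpha>"
  shows "multipliers (p - 1) (slce_ads \<alpha>) = {1} \<and>
    card (slce_family \<alpha>) = totient (p - 1) \<and>
    pairwise (\<lambda>a b. \<not> shift_equivalent (p - 1) a b) (slce_family \<alpha>)"
proof -
  obtain m where m: "p = 2 * m + 1"
    using \<open>odd p\<close> by (rule oddE)
  then interpret slce_prime_field \<alpha> m
    using assms by unfold_locales auto
  \<comment> \<open>Here \<open>p \<noteq> 5\<close> becomes \<open>m \<noteq> 2\<close>; for p = 5
    the residue 3 is a nontrivial multiplier.\<close>
  show ?thesis
    using multipliers_slce_ads slce_family_inequivalent \<open>p \<noteq> 5\<close> m by auto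
qed

end
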